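(* For integers $s,k\ge1$ and every $n\in\mathbb N$, $$\frac{J_k(n)}{n^k}=\sum_{q\ge1}\frac{\mu(q)}{\zeta(s+k)\,J_{s+k}(q)}\,c_q^{(s)}(n^s).$$
   Context: $J_k$ is the Jordan totient function: $J_k(n)=n^k\prod_{p\mid n}(1-p^{-k})$. $\mu$ is the Möbius function and $\zeta$ the Riemann zeta function. For a positive integer $s$ and integers $m,n$ not both zero, $(m,n)_s$ is the largest $l^s$ ($l\in\mathbb N$) dividing both; the Cohen-Ramanujan sum is $c_q^{(s)}(n)=\sum_{1\le a\le q^s,\ (a,q^s)_s=1} e^{2\pi i n a/q^s}$. *)

theory Defs
  imports "HOL-Analysis.Analysis" "HOL-Computational_Algebra.Computational_Algebra"
begin

definition moebius_mu :: "nat \<Rightarrow> int" where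
  "moebius_mu n = (if squarefree n then (-1) ^ card (prime_factors n) else 0)"

definition jordan_totient :: "nat \<Rightarrow> nat \<Rightarrow> real" where
  "jordan_totient k n = real n ^ k * (\<Prod>p\<in>prime_factors n. (1 - 1 / real p ^ k))"

text \<open>
  The Dirichlet series represents the Riemann zeta function only for \<open>Re z > 1\<close>; it is
  evaluated here only at integers \<open>\<ge> 2\<close>.
\<close>

definition riemann_zeta :: "complex \<Rightarrow> complex" where
  "riemann_zeta z = (\<Sum>n. 1 / of_nat (Suc n) powr z)"

text \<open>
  \<open>gen_gcd s m n\<close> is the generalised gcd \<open>(m, n)\<^sub>s\<close>. It is meaningful only for \<open>s \<ge> 1\<close> and
  \<open>m\<close>, \<open>n\<close> not both zero; otherwise the set below may be infinite.
\<close>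

definition gen_gcd :: "nat \<Rightarrow> int \<Rightarrow> int \<Rightarrow> int" where
  "gen_gcd s m n = Max {int l ^ s | l. 0 < l \<and> int l ^ s dvd m \<and> int l ^ s dvd n}"

text \<open>\<open>cohen_ramanujan s q n\<close> is the sum \<open>c\<^sub>q\<^sup>(\<^sup>s\<^sup>)(n)\<close>.\<close>

definition cohen_ramanujan :: "nat \<Rightarrow> nat \<Rightarrow> int \<Rightarrow> complex" where
  "cohen_ramanujan s q n =
     (\<Sum>a | 1 \<le> a \<and> a \<le> int q ^ s \<and> gen_gcd s a (int q ^ s) = 1.
        exp (2 * of_real pi * \<i> * of_int n * of_int a / of_nat q ^ s))"

end

theory Submission
  imports Defs
begin

text \<open>
  Put \<open>t = s + k\<close>. For squarefree \<open>q\<close> the factor \<open>1 / J\<^sub>t(q) = \<Prod>\<^sub>p\<^sub>|\<^sub>q 1 / (p\<^sup>t - 1)\<close> expands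
  geometrically into the sum of \<open>m\<^sup>-\<^sup>t\<close> over all \<open>m\<close> whose squarefree kernel is \<open>q\<close>, and
  \<open>\<mu>(q) c\<^sub>q(n\<^sup>s)\<close> is the sum \<open>F(q)\<close> of \<open>\<mu>(d) d\<^sup>s\<close> over the common divisors \<open>d\<close> of \<open>q\<close> and \<open>n\<close>.
  A squarefree \<open>d\<close> divides \<open>m\<close> iff it divides the kernel of \<open>m\<close>, so the series is
  \<open>1 / \<zeta>(t)\<close> times \<open>\<Sum>\<^sub>m F(m) m\<^sup>-\<^sup>t = \<Sum>\<^sub>d\<^sub>|\<^sub>n \<mu>(d) d\<^sup>s \<Sum>\<^sub>d\<^sub>|\<^sub>m m\<^sup>-\<^sup>t
  = \<zeta>(t) \<Sum>\<^sub>d\<^sub>|\<^sub>n \<mu>(d) d\<^sup>-\<^sup>k = \<zeta>(t) J\<^sub>k(n) / n\<^sup>k\<close>.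
\<close>

section \<open>Squarefree kernels\<close>

lemma prime_factors_prod_primes:
  fixes P :: "'a :: factorial_semiring set"
  assumes "finite P" and "\<And>p. p \<in> P \<Longrightarrow> prime p"
  shows "prime_factors (\<Prod>P) = P"
  using prime_factorization_prod_mset_primes[of "mset_set P"] assms
  by (simp add: prod_unfold_prod_mset)

lemma squarefree_prod_primes:
  fixes P :: "'a :: factorial_semiring_gcd set"
  assumes "\<And>p. p \<in> P \<Longrightarrow> prime p"
  shows "squarefree (\<Prod>P)"
  using assms by (intro squarefree_prod_coprime primes_coprime squarefree_prime)

lemma squarefree_dvd_iff_prime_factors_subset:
  fixes d m :: "'a :: factorial_semiring"
  assumes "squarefree d" and "m \<noteq> 0"
  shows "d dvd m \<longleftrightarrow> prime_factors d \<subseteq> prime_factors m"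
proof
  assume "d dvd m"
  with assms show "prime_factors d \<subseteq> prime_factors m"
    by (intro dvd_prime_factors)
next
  assume subset: "prime_factors d \<subseteq> prime_factors m"
  have "d \<noteq> 0" using assms by (metis not_squarefree_0)
  have "multiplicity p d \<le> multiplicity p m" if "prime p" for p
  proof (cases "p \<in> prime_factors d")
    case True
    then have "multiplicity p d = 1"
      using assms \<open>d \<noteq> 0\<close> by (simp add: squarefree_factorial_semiring')
    moreover have "multiplicity p m > 0"
      using True subset by (auto simp: prime_factors_multiplicity)
    ultimately show ?thesis by simp
  qed (use that in \<open>auto simp: prime_factors_multiplicity\<close>)
  with \<open>d \<noteq> 0\<close> show "d dvd m"
    by (rule multiplicity_le_imp_dvd)
qed

lemma squarefree_mult_imp_coprime:
  fixes a b :: "'a :: semiring_gcd"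
  assumes "squarefree (a * b)"
  shows "coprime a b"
proof (rule coprimeI)
  fix c assume "c dvd a" "c dvd b"
  then have "c ^ 2 dvd a * b" by (simp add: power2_eq_square mult_dvd_mono)
  with assms show "is_unit c" by (rule squarefreeD)
qed

definition squarefree_kernel :: "'a :: factorial_semiring \<Rightarrow> 'a" where
  "squarefree_kernel n = \<Prod>(prime_factors n)"

lemma prime_factors_squarefree_kernel [simp]:
  "prime_factors (squarefree_kernel n) = prime_factors n"
  unfolding squarefree_kernel_def by (intro prime_factors_prod_primes) auto

lemma squarefree_squarefree_kernel [simp]:
  fixes n :: "'a :: factorial_semiring_gcd"
  shows "squarefree (squarefree_kernel n)"
  unfolding squarefree_kernel_def by (intro squarefree_prod_primes) auto

lemma squarefree_kernel_squarefree:
  fixes n :: "'a :: factorial_semiring_multiplicative"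
  assumes "squarefree n"
  shows "squarefree_kernel n = normalize n"
proof -
  have "n \<noteq> 0" using assms by (metis not_squarefree_0)
  with assms have "(\<Prod>p\<in>prime_factors n. p ^ multiplicity p n) = squarefree_kernel n"
    unfolding squarefree_kernel_def
    by (intro prod.cong) (auto simp: squarefree_factorial_semiring')
  with prod_prime_factors[OF \<open>n \<noteq> 0\<close>] show ?thesis by simp
qed

lemma squarefree_dvd_squarefree_kernel_iff:
  fixes d n :: "'a :: factorial_semiring_gcd"
  assumes "squarefree d" and "n \<noteq> 0"
  shows "d dvd squarefree_kernel n \<longleftrightarrow> d dvd n"
proof -
  have "squarefree_kernel n \<noteq> 0"
    by (metis not_squarefree_0 squarefree_squarefree_kernel)
  with assms show ?thesis
    by (simp add: squarefree_dvd_iff_prime_factors_subset)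
qed

lemma squarefree_kernel_eq_iff_prime_factors_eq:
  fixes q m :: nat
  assumes "squarefree q"
  shows "squarefree_kernel m = q \<longleftrightarrow> prime_factors m = prime_factors q"
proof
  assume "prime_factors m = prime_factors q"
  then have "squarefree_kernel m = squarefree_kernel q"
    by (simp add: squarefree_kernel_def)
  with assms show "squarefree_kernel m = q"
    by (simp add: squarefree_kernel_squarefree)
qed auto

section \<open>Moebius sums over divisors\<close>

lemma moebius_mu_mult_coprime:
  assumes "coprime a b"
  shows "moebius_mu (a * b) = moebius_mu a * moebius_mu b"
proof (cases "squarefree a \<and> squarefree b")
  case True
  then have "a \<noteq> 0" "b \<noteq> 0" by (metis not_squarefree_0)+
  moreover have "prime_factors a \<inter> prime_factors b = {}"
    using assms by (auto simp: in_prime_factors_iff dest: coprime_common_divisor)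
  ultimately have "card (prime_factors (a * b)) = card (prime_factors a) + card (prime_factors b)"
    by (simp add: prime_factors_product card_Un_disjoint)
  with True assms show ?thesis
    by (simp add: moebius_mu_def squarefree_mult_coprime power_add)
next
  case False
  then show ?thesis by (auto simp: moebius_mu_def dest: squarefree_multD)
qed

lemma moebius_mu_mult_self:
  assumes "squarefree n"
  shows "moebius_mu n * moebius_mu n = 1"
  using assms by (simp add: moebius_mu_def flip: power_mult_distrib)

lemma sum_moebius_mu_dvd_squarefree_kernel:
  fixes f :: "nat \<Rightarrow> 'a :: comm_ring_1"
  assumes "finite D" and "m > 0"
  shows "(\<Sum>d | d \<in> D \<and> d dvd squarefree_kernel m. of_int (moebius_mu d) * f d) =
    (\<Sum>d | d \<in> D \<and> d dvd m. of_int (moebius_mu d) * f d)"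
proof -
  have "moebius_mu d = 0 \<or> (d dvd squarefree_kernel m \<longleftrightarrow> d dvd m)" for d
    using assms(2) by (simp add: moebius_mu_def squarefree_dvd_squarefree_kernel_iff)
  with assms(1) show ?thesis
    by (intro sum.mono_neutral_cong) force+
qed

lemma bij_betw_prod_squarefree_divisors:
  fixes n :: nat
  assumes "n > 0"
  shows "bij_betw (\<lambda>X. \<Prod>X) (Pow (prime_factors n)) {d. d dvd n \<and> squarefree d}"
proof (rule bij_betw_byWitness[where f' = prime_factors])
  have prime_factors_prod: "prime_factors (\<Prod>X) = X" if "X \<subseteq> prime_factors n" for X
    using that by (intro prime_factors_prod_primes) (auto intro: finite_subset)
  then show "\<forall>X\<in>Pow (prime_factors n). prime_factors (\<Prod>X) = X" by blast
  show "\<forall>d\<in>{d. d dvd n \<and> squarefree d}. \<Prod>(prime_factors d) = d"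
    using squarefree_kernel_squarefree[where 'a = nat] by (simp add: squarefree_kernel_def)
  have "squarefree (\<Prod>X)" if "X \<subseteq> prime_factors n" for X
    using that by (intro squarefree_prod_primes) auto
  with prime_factors_prod assms
  show "(\<lambda>X. \<Prod>X) ` Pow (prime_factors n) \<subseteq> {d. d dvd n \<and> squarefree d}"
    by (auto simp: squarefree_dvd_iff_prime_factors_subset)
  show "prime_factors ` {d. d dvd n \<and> squarefree d} \<subseteq> Pow (prime_factors n)"
    using assms by (auto dest: dvd_prime_factors[rotated])
qed

lemma multiplicative_prod_primes:
  fixes f :: "nat \<Rightarrow> 'a :: comm_monoid_mult"
  assumes one: "f 1 = 1" and mult: "\<And>a b. coprime a b \<Longrightarrow> f (a * b) = f a * f b"
    and "finite P" and "\<And>p. p \<in> P \<Longrightarrow> prime p"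
  shows "f (\<Prod>P) = (\<Prod>p\<in>P. f p)"
  using assms(3,4)
proof (induction P rule: finite_induct)
  case empty
  show ?case using one by simp
next
  case (insert p P)
  then have "coprime p (\<Prod>P)"
    by (intro prod_coprime_right primes_coprime) auto
  with insert show ?case by (simp add: mult)
qed

lemma sum_divisors_moebius_mu_mult:
  fixes f :: "nat \<Rightarrow> 'a :: comm_ring_1"
  assumes "n > 0" and one: "f 1 = 1"
    and mult: "\<And>a b. coprime a b \<Longrightarrow> f (a * b) = f a * f b"
  shows "(\<Sum>d | d dvd n. of_int (moebius_mu d) * f d) = (\<Prod>p\<in>prime_factors n. 1 - f p)"
proof -
  have "(\<Sum>d | d dvd n. of_int (moebius_mu d) * f d) =
      (\<Sum>d | d dvd n \<and> squarefree d. of_int (moebius_mu d) * f d)"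
    using assms(1) by (intro sum.mono_neutral_right) (auto simp: moebius_mu_def)
  also have "\<dots> = (\<Sum>X\<in>Pow (prime_factors n). of_int (moebius_mu (\<Prod>X)) * f (\<Prod>X))"
    using bij_betw_prod_squarefree_divisors[OF assms(1)]
    by (rule sum.reindex_bij_betw[symmetric])
  also have "\<dots> = (\<Sum>X\<in>Pow (prime_factors n). (-1) ^ card X * (\<Prod>p\<in>X. f p))"
  proof (rule sum.cong)
    fix X assume "X \<in> Pow (prime_factors n)"
    then have X_primes: "finite X" "\<And>p. p \<in> X \<Longrightarrow> prime p"
      by (auto intro: finite_subset)
    then have "moebius_mu (\<Prod>X) = (-1) ^ card X"
      by (simp add: moebius_mu_def prime_factors_prod_primes squarefree_prod_primes)
    with X_primes show "of_int (moebius_mu (\<Prod>X)) * f (\<Prod>X) = (-1) ^ card X * (\<Prod>p\<in>X. f p)"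
      by (simp add: multiplicative_prod_primes[OF one mult])
  qed simp
  also have "\<dots> = (\<Prod>p\<in>prime_factors n. 1 - f p)"
    by (simp add: prod_diff_conv_sum)
  finally show ?thesis .
qed

lemma jordan_totient_div_power:
  assumes "n > 0"
  shows "of_real (jordan_totient k n / real n ^ k) =
    (\<Sum>d | d dvd n. of_int (moebius_mu d) / of_nat d ^ k :: 'a :: real_field)"
proof -
  have "jordan_totient k n / real n ^ k = (\<Prod>p\<in>prime_factors n. 1 - 1 / real p ^ k)"
    using assms by (simp add: jordan_totient_def)
  then have "of_real (jordan_totient k n / real n ^ k) =
      (\<Prod>p\<in>prime_factors n. 1 - 1 / of_nat p ^ k :: 'a)"
    by simp
  also have "\<dots> = (\<Sum>d | d dvd n. of_int (moebius_mu d) * (1 / of_nat d ^ k))"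
    using assms
    by (intro sum_divisors_moebius_mu_mult[symmetric]) (simp_all add: power_mult_distrib)
  finally show ?thesis by simp
qed

lemma jordan_totient_squarefree:
  assumes "squarefree q"
  shows "jordan_totient t q = (\<Prod>p\<in>prime_factors q. real p ^ t - 1)"
proof -
  have "real q ^ t = (\<Prod>p\<in>prime_factors q. real p ^ t)"
    using squarefree_kernel_squarefree[OF assms]
    by (simp add: squarefree_kernel_def flip: prod_power_distrib of_nat_prod)
  then have "jordan_totient t q = (\<Prod>p\<in>prime_factors q. real p ^ t * (1 - 1 / real p ^ t))"
    by (simp add: jordan_totient_def prod.distrib)
  also have "\<dots> = (\<Prod>p\<in>prime_factors q. real p ^ t - 1)"
    by (intro prod.cong refl) (auto simp: right_diff_distrib dest: prime_factors_gt_0_nat)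
  finally show ?thesis .
qed

section \<open>Cohen--Ramanujan sums\<close>

lemma gen_gcd_eq_1_iff:
  assumes "s \<ge> 1" and "b \<noteq> 0"
  shows "gen_gcd s a b = 1 \<longleftrightarrow> (\<forall>p. prime p \<longrightarrow> \<not> (int p ^ s dvd a \<and> int p ^ s dvd b))"
proof -
  define S where "S = {int l ^ s | l. 0 < l \<and> int l ^ s dvd a \<and> int l ^ s dvd b}"
  have "S \<subseteq> {..\<bar>b\<bar>}"
    using assms by (auto simp: S_def intro!: zdvd_imp_le)
  moreover have "S \<subseteq> {0..}" by (auto simp: S_def)
  ultimately have "finite S"
    by (intro finite_subset[of S "{0..\<bar>b\<bar>}"]) auto
  moreover have "1 \<in> S" unfolding S_def by (auto intro!: exI[of _ 1])
  ultimately have "gen_gcd s a b = 1 \<longleftrightarrow> (\<forall>x\<in>S. x \<le> 1)"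
    unfolding gen_gcd_def S_def[symmetric] by (metis Max_eq_iff empty_iff)
  also have "\<dots> \<longleftrightarrow> (\<forall>p. prime p \<longrightarrow> \<not> (int p ^ s dvd a \<and> int p ^ s dvd b))"
  proof (intro iffI allI impI notI ballI)
    fix p :: nat
    assume S_le_1: "\<forall>x\<in>S. x \<le> 1" and "prime p" "int p ^ s dvd a \<and> int p ^ s dvd b"
    then have "int p ^ s \<in> S" by (auto simp: S_def prime_gt_0_nat)
    moreover have "int p ^ s > 1"
      using prime_gt_1_nat[OF \<open>prime p\<close>] assms by (intro one_less_power) auto
    ultimately show False using S_le_1 by force
  next
    fix x
    assume no_prime: "\<forall>p. prime p \<longrightarrow> \<not> (int p ^ s dvd a \<and> int p ^ s dvd b)" and "x \<in> S"
    then obtain l where "x = int l ^ s" and l_dvd: "int l ^ s dvd a" "int l ^ s dvd b"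
      by (auto simp: S_def)
    have "int p ^ s dvd int l ^ s" if "p dvd l" for p
      using that by (intro dvd_power_same) simp
    with l_dvd no_prime have "\<not> p dvd l" if "prime p" for p
      using that by (blast intro: dvd_trans)
    then have "l = 1" using prime_factor_nat by blast
    with \<open>x = int l ^ s\<close> show "x \<le> 1" by simp
  qed
  finally show ?thesis .
qed

lemma sum_moebius_mu_common_power_divisors:
  assumes "s \<ge> 1" and "q > 0"
  shows "(\<Sum>d | d dvd q \<and> int d ^ s dvd a. moebius_mu d) = of_bool (gen_gcd s a (int q ^ s) = 1)"
proof -
  have "(\<Sum>d | d dvd q \<and> int d ^ s dvd a. moebius_mu d) =
      (\<Sum>d | d dvd q. of_int (moebius_mu d) * of_bool (int d ^ s dvd a))"
    using assms by (intro sum.mono_neutral_cong_left) auto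
  also have "\<dots> = (\<Prod>p\<in>prime_factors q. 1 - of_bool (int p ^ s dvd a))"
  proof (rule sum_divisors_moebius_mu_mult)
    fix l m :: nat assume "coprime l m"
    then have "coprime (int l ^ s) (int m ^ s)" by simp
    then show "of_bool (int (l * m) ^ s dvd a) =
        (of_bool (int l ^ s dvd a) * of_bool (int m ^ s dvd a) :: int)"
      by (auto simp: power_mult_distrib intro: divides_mult dvd_mult_left dvd_mult_right)
  qed (use assms in auto)
  also have "\<dots> = of_bool (\<forall>p\<in>prime_factors q. \<not> int p ^ s dvd a)"
    by (auto intro!: prod.neutral)
  also have "(\<forall>p\<in>prime_factors q. \<not> int p ^ s dvd a) \<longleftrightarrow> gen_gcd s a (int q ^ s) = 1"
    using assms by (auto simp: gen_gcd_eq_1_iff prime_factors_dvd)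
  finally show ?thesis .
qed

lemma sum_exp_2pi_i_full_period:
  assumes "M > 0"
  shows "(\<Sum>b\<in>{1..int M}. exp (2 * of_real pi * \<i> * of_int N * of_int b / of_nat M)) =
    (if int M dvd N then of_nat M else 0 :: complex)"
proof -
  define w :: complex where "w = exp (2 * of_real pi * \<i> * of_int N / of_nat M)"
  have "w ^ M = exp (2 * of_real pi * \<i> * of_int N)"
    using assms by (simp add: w_def flip: exp_of_nat_mult)
  then have "w ^ M = 1" by (simp add: exp_eq_1)
  have "w = 1 \<longleftrightarrow> (\<exists>c. real_of_int N = real_of_int (int M * c))"
    using assms by (auto simp: w_def exp_eq_1 field_simps)
  then have w_eq_1_iff: "w = 1 \<longleftrightarrow> int M dvd N"
    unfolding of_int_eq_iff dvd_def .
  have "(\<Sum>b\<in>{1..int M}. exp (2 * of_real pi * \<i> * of_int N * of_int b / of_nat M)) =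
      (\<Sum>b\<in>int ` {1..M}. exp (2 * of_real pi * \<i> * of_int N * of_int b / of_nat M))"
    by (simp add: image_int_atLeastAtMost)
  also have "\<dots> = (\<Sum>b=1..M. w ^ b)"
    by (subst sum.reindex) (auto simp: w_def mult_ac simp flip: exp_of_nat_mult)
  also have "\<dots> = (if int M dvd N then of_nat M else 0)"
    using assms \<open>w ^ M = 1\<close> by (simp add: sum_gp w_eq_1_iff)
  finally show ?thesis .
qed

lemma sum_multiples:
  fixes f :: "int \<Rightarrow> 'a :: comm_monoid_add"
  assumes "l > 0"
  shows "(\<Sum>a | a \<in> {1..l * m} \<and> l dvd a. f a) = (\<Sum>b\<in>{1..m}. f (l * b))"
proof -
  have "l * b \<in> {1..l * m} \<longleftrightarrow> b \<in> {1..m}" for b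
  proof -
    have "1 \<le> l * b \<longleftrightarrow> 1 \<le> b"
      using assms by (metis int_one_le_iff_zero_less mult_pos_pos zero_less_mult_pos)
    with assms show ?thesis by simp
  qed
  then have "{a \<in> {1..l * m}. l dvd a} = (*) l ` {1..m}"
    unfolding dvd_def image_def by blast
  moreover have "inj_on ((*) l) {1..m}"
    using assms by (simp add: inj_on_def)
  ultimately show ?thesis by (simp add: sum.reindex)
qed

lemma sum_exp_2pi_i_multiples:
  assumes "l > 0" and "d > 0"
  shows "(\<Sum>a | a \<in> {1..int (l * d)} \<and> int l dvd a.
      exp (2 * of_real pi * \<i> * of_int N * of_int a / of_nat (l * d))) =
    (if int d dvd N then of_nat d else 0 :: complex)"
proof -
  have "(\<Sum>a | a \<in> {1..int (l * d)} \<and> int l dvd a.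
        exp (2 * of_real pi * \<i> * of_int N * of_int a / of_nat (l * d))) =
      (\<Sum>b\<in>{1..int d}. exp (2 * of_real pi * \<i> * of_int N * of_int (int l * b) / of_nat (l * d)))"
    unfolding of_nat_mult[where 'a = int] using assms by (intro sum_multiples) simp
  also have "\<dots> = (\<Sum>b\<in>{1..int d}. exp (2 * of_real pi * \<i> * of_int N * of_int b / of_nat d))"
    using assms by (intro sum.cong refl arg_cong[of _ _ exp]) (simp add: field_simps)
  also have "\<dots> = (if int d dvd N then of_nat d else 0)"
    using assms by (intro sum_exp_2pi_i_full_period)
  finally show ?thesis .
qed

lemma cohen_ramanujan_eq_divisor_sum:
  assumes "s \<ge> 1" and "q > 0"
  shows "cohen_ramanujan s q m =
    (\<Sum>d | d dvd q \<and> int d ^ s dvd m. of_int (moebius_mu (q div d)) * of_nat d ^ s)"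
proof -
  define e where "e a = exp (2 * of_real pi * \<i> * of_int m * of_int a / of_nat q ^ s)" for a
  have sum_e_multiples: "(\<Sum>a | a \<in> {1..int q ^ s} \<and> int l ^ s dvd a. e a) =
      (if int (q div l) ^ s dvd m then of_nat (q div l) ^ s else 0)" if "l dvd q" for l
  proof -
    from that obtain d where "q = l * d" ..
    with assms sum_exp_2pi_i_multiples[of "l ^ s" "d ^ s" m] show ?thesis
      by (simp add: e_def power_mult_distrib)
  qed
  have "cohen_ramanujan s q m =
      (\<Sum>a\<in>{1..int q ^ s}. of_int (of_bool (gen_gcd s a (int q ^ s) = 1)) * e a)"
    unfolding cohen_ramanujan_def e_def by (intro sum.mono_neutral_cong_left) auto
  also have "\<dots> = (\<Sum>a\<in>{1..int q ^ s}. \<Sum>l | l \<in> {l. l dvd q} \<and> int l ^ s dvd a.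
      of_int (moebius_mu l) * e a)"
    by (simp add: sum_distrib_right flip: sum_moebius_mu_common_power_divisors[OF assms])
  also have "\<dots> = (\<Sum>l | l dvd q. \<Sum>a | a \<in> {1..int q ^ s} \<and> int l ^ s dvd a.
      of_int (moebius_mu l) * e a)"
    using assms by (intro sum.swap_restrict) auto
  also have "\<dots> = (\<Sum>l | l dvd q. of_int (moebius_mu l) *
      (if int (q div l) ^ s dvd m then of_nat (q div l) ^ s else 0))"
    by (intro sum.cong refl) (simp only: sum_e_multiples mem_Collect_eq flip: sum_distrib_left)
  also have "\<dots> = (\<Sum>d | d dvd q. of_int (moebius_mu (q div d)) *
      (if int d ^ s dvd m then of_nat d ^ s else 0))"
    by (rule sum.reindex_bij_witness[of _ "\<lambda>d. q div d" "\<lambda>d. q div d"]) (use assms in auto)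
  also have "\<dots> = (\<Sum>d | d dvd q \<and> int d ^ s dvd m. of_int (moebius_mu (q div d)) * of_nat d ^ s)"
    using assms by (intro sum.mono_neutral_cong_right) auto
  finally show ?thesis .
qed

lemma moebius_mu_mult_cohen_ramanujan:
  assumes "s \<ge> 1" and "squarefree q"
  shows "of_int (moebius_mu q) * cohen_ramanujan s q m =
    (\<Sum>d | d dvd q \<and> int d ^ s dvd m. of_int (moebius_mu d) * of_nat d ^ s)"
proof -
  have "q > 0" using assms by (metis gr0I not_squarefree_0)
  have "moebius_mu q * moebius_mu (q div d) = moebius_mu d" if "d dvd q" for d
  proof -
    from that obtain e where "q = d * e" ..
    with assms have "coprime d e" "squarefree e"
      by (auto intro: squarefree_mult_imp_coprime dest: squarefree_multD)
    then show ?thesis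
      using \<open>q = d * e\<close> \<open>q > 0\<close>
      by (simp add: moebius_mu_mult_coprime moebius_mu_mult_self mult.assoc)
  qed
  then have "of_int (moebius_mu q) * (of_int (moebius_mu (q div d)) * of_nat d ^ s) =
      (of_int (moebius_mu d) * of_nat d ^ s :: complex)" if "d dvd q" for d
    using that by (simp flip: mult.assoc of_int_mult)
  then show ?thesis
    unfolding cohen_ramanujan_eq_divisor_sum[OF assms(1) \<open>q > 0\<close>] sum_distrib_left
    by (intro sum.cong) auto
qed

section \<open>Dirichlet series\<close>

lemma has_sum_sum:
  fixes f :: "'i \<Rightarrow> 'a \<Rightarrow> 'b :: topological_comm_monoid_add"
  assumes "\<And>i. i \<in> I \<Longrightarrow> (f i has_sum S i) A"
  shows "((\<lambda>x. \<Sum>i\<in>I. f i x) has_sum (\<Sum>i\<in>I. S i)) A"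
  using assms by (induction I rule: infinite_finite_induct) (auto intro: has_sum_add)

lemma has_sum_greaterThan_0_iff:
  fixes f :: "nat \<Rightarrow> 'a :: {comm_monoid_add, topological_space}"
  shows "(f has_sum S) {0<..} \<longleftrightarrow> ((\<lambda>n. f (Suc n)) has_sum S) UNIV"
proof -
  have "bij_betw Suc UNIV {0<..}"
    by (simp add: bij_betw_def flip: greaterThan_0)
  then show ?thesis
    by (rule has_sum_reindex_bij_betw[symmetric])
qed

lemma has_sum_riemann_zeta:
  assumes "t \<ge> 2"
  shows "((\<lambda>m. 1 / of_nat m ^ t) has_sum riemann_zeta (of_nat t)) {0<..}"
  unfolding has_sum_greaterThan_0_iff
proof (rule norm_summable_imp_has_sum)
  have "summable (\<lambda>n. inverse (real (Suc n) ^ t))"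
    using inverse_power_summable[OF assms]
    by (rule summable_ignore_initial_segment[where k = 1, simplified])
  then show "summable (\<lambda>n. norm (1 / of_nat (Suc n) ^ t :: complex))"
    by (simp add: norm_inverse norm_power divide_inverse del: of_nat_Suc)
  then have "(\<lambda>n. 1 / of_nat (Suc n) ^ t :: complex) sums (\<Sum>n. 1 / of_nat (Suc n) ^ t)"
    by (rule summable_norm_cancel[THEN summable_sums])
  moreover have "(of_nat (Suc n) :: complex) powr of_nat t = of_nat (Suc n) ^ t" for n
    by (subst powr_nat') (simp_all del: of_nat_Suc)
  ultimately show "(\<lambda>n. 1 / of_nat (Suc n) ^ t) sums riemann_zeta (of_nat t)"
    by (simp add: riemann_zeta_def)
qed

lemma riemann_zeta_of_nat_neq_0:
  assumes "t \<ge> 2"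
  shows "riemann_zeta (of_nat t) \<noteq> 0"
proof -
  have "Re (1 / of_nat m ^ t) = 1 / real m ^ t" for m
    using Re_complex_of_real[of "1 / real m ^ t"] by simp
  with has_sum_Re[OF has_sum_riemann_zeta[OF assms]]
  have "((\<lambda>m. 1 / real m ^ t) has_sum Re (riemann_zeta (of_nat t))) {0<..}" by simp
  then have "(\<Sum>m\<in>{1}. 1 / real m ^ t) \<le> Re (riemann_zeta (of_nat t))"
    by (rule finite_sum_le_has_sum) auto
  then show ?thesis by auto
qed

lemma has_sum_multiples_inverse_power:
  assumes "t \<ge> 2" and "d > 0"
  shows "((\<lambda>m. of_bool (d dvd m) / of_nat m ^ t) has_sum
    (riemann_zeta (of_nat t) / of_nat d ^ t)) {0<..}"
proof -
  have "((\<lambda>m. 1 / of_nat m ^ t / of_nat d ^ t) has_sum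
      (riemann_zeta (of_nat t) / of_nat d ^ t)) {0<..}"
    by (intro has_sum_divide_const has_sum_riemann_zeta assms)
  then have "((\<lambda>m. 1 / of_nat (d * m) ^ t) has_sum
      (riemann_zeta (of_nat t) / of_nat d ^ t)) {0<..}"
    by (simp add: power_mult_distrib mult.commute)
  moreover have "bij_betw ((*) d) {0<..} {m. m > 0 \<and> d dvd m}"
    using assms by (auto simp: bij_betw_def inj_on_def elim!: dvdE)
  ultimately have "((\<lambda>m. 1 / of_nat m ^ t) has_sum (riemann_zeta (of_nat t) / of_nat d ^ t))
      {m. m > 0 \<and> d dvd m}"
    using has_sum_reindex_bij_betw by fast
  then show ?thesis
    by (rule has_sum_cong_neutral[THEN iffD1, rotated -1]) auto
qed

lemma has_sum_divisor_sum_over_power: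
  fixes a :: "nat \<Rightarrow> complex"
  assumes "t \<ge> 2" and "finite D" and "0 \<notin> D"
  shows "((\<lambda>m. (\<Sum>d | d \<in> D \<and> d dvd m. a d) / of_nat m ^ t) has_sum
    (riemann_zeta (of_nat t) * (\<Sum>d\<in>D. a d / of_nat d ^ t))) {0<..}"
proof -
  have "((\<lambda>m. \<Sum>d\<in>D. a d * (of_bool (d dvd m) / of_nat m ^ t)) has_sum
      (\<Sum>d\<in>D. a d * (riemann_zeta (of_nat t) / of_nat d ^ t))) {0<..}"
    using assms
    by (intro has_sum_sum has_sum_cmult_right has_sum_multiples_inverse_power) (auto intro: gr0I)
  moreover have "(\<Sum>d | d \<in> D \<and> d dvd m. a d) = (\<Sum>d\<in>D. a d * of_bool (d dvd m))" for m
    using assms(2) by (intro sum.mono_neutral_cong_left) auto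
  ultimately show ?thesis
    by (simp add: sum_divide_distrib sum_distrib_left mult.commute)
qed

lemma bij_betw_prod_prime_powers:
  fixes P :: "nat set"
  assumes "finite P" and prime: "\<And>p. p \<in> P \<Longrightarrow> prime p"
  shows "bij_betw (\<lambda>e :: nat \<Rightarrow> nat. \<Prod>p\<in>P. p ^ e p) (P \<rightarrow>\<^sub>E {0<..}) {m. m > 0 \<and> prime_factors m = P}"
proof (rule bij_betw_byWitness[where f' = "\<lambda>m. \<lambda>p\<in>P. multiplicity p m"])
  note multiplicity_prod = multiplicity_prod_prime_powers[OF assms]
  show "\<forall>e\<in>P \<rightarrow>\<^sub>E {0<..}. (\<lambda>p\<in>P. multiplicity p (\<Prod>p\<in>P. p ^ e p)) = e"
    using prime by (auto simp: multiplicity_prod PiE_def intro: extensionalityI)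
  show "\<forall>m\<in>{m. m > 0 \<and> prime_factors m = P}. (\<Prod>p\<in>P. p ^ (\<lambda>p\<in>P. multiplicity p m) p) = m"
    using prod_prime_factors[where 'a = nat] by auto
  show "(\<lambda>e. \<Prod>p\<in>P. p ^ e p) ` (P \<rightarrow>\<^sub>E {0<..}) \<subseteq> {m. m > 0 \<and> prime_factors m = P}"
  proof safe
    fix e :: "nat \<Rightarrow> nat" and p assume e_PiE: "e \<in> P \<rightarrow>\<^sub>E {0<..}"
    show "(\<Prod>p\<in>P. p ^ e p) > 0"
      using prime by (intro prod_pos) (auto dest: prime_gt_0_nat)
    have "p \<in> prime_factors (\<Prod>p\<in>P. p ^ e p) \<longleftrightarrow> p \<in> P"
      using e_PiE prime by (auto simp: prime_factors_multiplicity multiplicity_prod)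
    then show "p \<in> prime_factors (\<Prod>p\<in>P. p ^ e p) \<Longrightarrow> p \<in> P"
      "p \<in> P \<Longrightarrow> p \<in> prime_factors (\<Prod>p\<in>P. p ^ e p)" by simp_all
  qed
  show "(\<lambda>m. \<lambda>p\<in>P. multiplicity p m) ` {m. m > 0 \<and> prime_factors m = P} \<subseteq> P \<rightarrow>\<^sub>E {0<..}"
    by (auto simp: prime_factors_multiplicity)
qed

lemma summable_on_powers_imp_norm_less_1:
  fixes f :: "nat \<Rightarrow> 'a :: {real_normed_field, banach}"
  assumes power: "\<And>j. f (p ^ j) = f p ^ j"
    and "f summable_on {0<..}" and "p > 1"
  shows "norm (f p) < 1"
proof -
  have "inj (\<lambda>j. p ^ j)" using assms(3) by (simp add: inj_on_def)
  moreover have "f summable_on range (\<lambda>j. p ^ j)"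
    using assms(2) by (rule summable_on_subset_banach) (use assms(3) in auto)
  ultimately have "(f \<circ> (\<lambda>j. p ^ j)) summable_on UNIV"
    using summable_on_reindex by blast
  then have "summable (\<lambda>j. f p ^ j)"
    using summable_on_imp_summable by (fastforce simp: o_def power)
  then show ?thesis by simp
qed

lemma has_sum_prime_factors_eq:
  fixes f :: "nat \<Rightarrow> 'a :: {real_normed_field, banach}"
  assumes one: "f 1 = 1" and mult: "\<And>a b. f (a * b) = f a * f b"
    and summable: "f summable_on {0<..}"
    and "finite P" and prime: "\<And>p. p \<in> P \<Longrightarrow> prime p"
  shows "(f has_sum (\<Prod>p\<in>P. f p / (1 - f p))) {m. m > 0 \<and> prime_factors m = P}"
proof -
  have f_power: "f (m ^ j) = f m ^ j" for m j
    using one by (induction j) (simp_all add: mult)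
  have f_prod: "f (\<Prod>p\<in>P. p ^ e p) = (\<Prod>p\<in>P. f p ^ e p)" for e
    using \<open>finite P\<close> one by (induction P rule: finite_induct) (simp_all add: mult f_power)
  note bij = bij_betw_prod_prime_powers[OF \<open>finite P\<close> prime]
  have geometric: "((\<lambda>j. f p ^ j) has_sum (f p / (1 - f p))) {0<..}" if "p \<in> P" for p
  proof -
    have "p > 1" using prime[OF that] by (rule prime_gt_1_nat)
    with f_power summable have "norm (f p) < 1" by (rule summable_on_powers_imp_norm_less_1)
    then show ?thesis using has_sum_geometric_from_1 by (simp add: atLeast_Suc_greaterThan)
  qed
  have "f summable_on {m. m > 0 \<and> prime_factors m = P}"
    using summable by (rule summable_on_subset_banach) auto
  then have summable_prod: "(\<lambda>e. \<Prod>p\<in>P. f p ^ e p) summable_on (P \<rightarrow>\<^sub>E {0<..})"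
    using summable_on_reindex_bij_betw[OF bij, of f] by (simp add: f_prod)
  then have "(\<Sum>\<^sub>\<infinity>e\<in>P \<rightarrow>\<^sub>E {0<..}. \<Prod>p\<in>P. f p ^ e p) =
      (\<Prod>p\<in>P. \<Sum>\<^sub>\<infinity>j\<in>{0<..}. f p ^ j)"
    using \<open>finite P\<close> geometric by (intro infsum_prod_PiE) (auto dest: has_sum_imp_summable)
  also have "\<dots> = (\<Prod>p\<in>P. f p / (1 - f p))"
    by (intro prod.cong refl infsumI geometric)
  finally have "((\<lambda>e. f (\<Prod>p\<in>P. p ^ e p)) has_sum
      (\<Prod>p\<in>P. f p / (1 - f p))) (P \<rightarrow>\<^sub>E {0<..})"
    using summable_prod by (simp add: has_sum_iff f_prod)
  then show ?thesis
    by (simp add: has_sum_reindex_bij_betw[OF bij])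
qed

lemma has_sum_inverse_jordan_totient:
  assumes "t \<ge> 2" and "squarefree q"
  shows "((\<lambda>m. 1 / of_nat m ^ t) has_sum (1 / complex_of_real (jordan_totient t q)))
    {m. m > 0 \<and> squarefree_kernel m = q}"
proof -
  have "((\<lambda>m. 1 / of_nat m ^ t) has_sum
      (\<Prod>p\<in>prime_factors q. 1 / of_nat p ^ t / (1 - 1 / of_nat p ^ t :: complex)))
      {m. m > 0 \<and> prime_factors m = prime_factors q}"
    using has_sum_riemann_zeta[OF assms(1)]
    by (intro has_sum_prime_factors_eq) (auto simp: power_mult_distrib dest: has_sum_imp_summable)
  also have "(\<Prod>p\<in>prime_factors q. 1 / of_nat p ^ t / (1 - 1 / of_nat p ^ t :: complex)) =
      (\<Prod>p\<in>prime_factors q. 1 / (of_nat p ^ t - 1))"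
    by (intro prod.cong refl) (auto simp: divide_simps dest: prime_factors_gt_0_nat)
  also have "\<dots> = 1 / complex_of_real (jordan_totient t q)"
    using assms by (simp add: jordan_totient_squarefree prod_dividef)
  finally show ?thesis
    using assms by (simp add: squarefree_kernel_eq_iff_prime_factors_eq)
qed

lemma has_sum_group_by_squarefree_kernel:
  fixes F :: "nat \<Rightarrow> complex"
  assumes "t \<ge> 2"
    and "((\<lambda>m. F (squarefree_kernel m) / of_nat m ^ t) has_sum S) {0<..}"
  shows "((\<lambda>q. F q / of_real (jordan_totient t q)) has_sum S) {q. squarefree q}"
proof (rule has_sum_SigmaD)
  let ?fiber = "\<lambda>q :: nat. {m. m > 0 \<and> squarefree_kernel m = q}"
  have "bij_betw snd (SIGMA q:{q. squarefree q}. ?fiber q) {0<..}"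
    by (rule bij_betw_byWitness[where f' = "\<lambda>m. (squarefree_kernel m, m)"]) auto
  from assms(2)[folded has_sum_reindex_bij_betw[OF this]]
  show "((\<lambda>(q, m). F q / of_nat m ^ t) has_sum S) (SIGMA q:{q. squarefree q}. ?fiber q)"
    by (rule has_sum_cong[THEN iffD1, rotated]) auto
  fix q :: nat assume "q \<in> {q. squarefree q}"
  then have "((\<lambda>m. F q * (1 / of_nat m ^ t)) has_sum
      (F q * (1 / of_real (jordan_totient t q)))) (?fiber q)"
    using assms(1) by (intro has_sum_cmult_right has_sum_inverse_jordan_totient) auto
  then show "((\<lambda>m. case (q, m) of (q, m) \<Rightarrow> F q / of_nat m ^ t) has_sum
      (F q / of_real (jordan_totient t q))) (?fiber q)"
    by simp
qed

lemma has_sum_moebius_mu_cohen_ramanujan_over_jordan_totient: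
  assumes "s \<ge> 1" and "k \<ge> 1" and "n > 0"
  shows "((\<lambda>q. of_int (moebius_mu q) * cohen_ramanujan s q (int n ^ s)
      / of_real (jordan_totient (s + k) q)) has_sum
    (riemann_zeta (of_nat (s + k)) * of_real (jordan_totient k n / real n ^ k))) {0<..}"
    (is "(_ has_sum ?S) _")
proof -
  define F :: "nat \<Rightarrow> complex"
    where "F q = (\<Sum>d | d \<in> {d. d dvd n} \<and> d dvd q. of_int (moebius_mu d) * of_nat d ^ s)" for q
  have "s + k \<ge> 2" using assms by simp
  have F_eq: "F q = of_int (moebius_mu q) * cohen_ramanujan s q (int n ^ s)"
    if "squarefree q" for q
    unfolding F_def moebius_mu_mult_cohen_ramanujan[OF assms(1) that]
    using assms(1) by (intro sum.cong) auto
  have F_kernel: "F (squarefree_kernel m) = F m" if "m > 0" for m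
    unfolding F_def using assms that by (intro sum_moebius_mu_dvd_squarefree_kernel) auto
  have "of_int (moebius_mu d) * of_nat d ^ s / of_nat d ^ (s + k) =
      (of_int (moebius_mu d) / of_nat d ^ k :: complex)" for d
    by (cases "d = 0") (simp_all add: moebius_mu_def power_add)
  then have "?S = riemann_zeta (of_nat (s + k)) *
      (\<Sum>d | d dvd n. of_int (moebius_mu d) * of_nat d ^ s / of_nat d ^ (s + k))"
    using jordan_totient_div_power[OF assms(3), where 'a = complex] by simp
  also have "((\<lambda>m. F m / of_nat m ^ (s + k)) has_sum \<dots>) {0<..}"
    unfolding F_def using assms \<open>s + k \<ge> 2\<close> by (intro has_sum_divisor_sum_over_power) auto
  finally have "((\<lambda>m. F (squarefree_kernel m) / of_nat m ^ (s + k)) has_sum ?S) {0<..}"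
    by (rule has_sum_cong[THEN iffD1, rotated]) (simp add: F_kernel)
  with \<open>s + k \<ge> 2\<close>
  have "((\<lambda>q. F q / of_real (jordan_totient (s + k) q)) has_sum ?S) {q. squarefree q}"
    by (rule has_sum_group_by_squarefree_kernel)
  also have "?this \<longleftrightarrow> ?thesis"
    by (intro has_sum_cong_neutral) (auto simp: F_eq moebius_mu_def intro: gr0I)
  finally show ?thesis .
qed

theorem theorem3p5:
  fixes s k n :: nat
  assumes "s \<ge> 1" and "k \<ge> 1" and "n \<ge> 1"
  shows "(\<lambda>j. let q = Suc j in
            of_int (moebius_mu q)
              / (riemann_zeta (of_nat (s + k)) * of_real (jordan_totient (s + k) q))
              * cohen_ramanujan s q (int n ^ s))
         sums complex_of_real (jordan_totient k n / real n ^ k)"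
proof -
  let ?\<zeta> = "riemann_zeta (of_nat (s + k))"
  have "?\<zeta> \<noteq> 0" using assms by (intro riemann_zeta_of_nat_neq_0) simp
  have "((\<lambda>q. of_int (moebius_mu q) * cohen_ramanujan s q (int n ^ s)
        / of_real (jordan_totient (s + k) q) / ?\<zeta>) has_sum
      (?\<zeta> * of_real (jordan_totient k n / real n ^ k) / ?\<zeta>)) {0<..}"
    using assms
    by (intro has_sum_divide_const has_sum_moebius_mu_cohen_ramanujan_over_jordan_totient) auto
  then have "(\<lambda>j. of_int (moebius_mu (Suc j)) * cohen_ramanujan s (Suc j) (int n ^ s)
        / of_real (jordan_totient (s + k) (Suc j)) / ?\<zeta>) sums
      (?\<zeta> * of_real (jordan_totient k n / real n ^ k) / ?\<zeta>)"
    unfolding has_sum_greaterThan_0_iff by (rule has_sum_imp_sums)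
  with \<open>?\<zeta> \<noteq> 0\<close> show ?thesis
    by (simp add: Let_def mult.commute)
qed

end
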